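(* Let $A$ and $B$ be nonempty subsets of a metric space $(X,d)$ endowed with a directed graph $G=(V(G),E(G))$ such that $V(G)=A\cup B$. Suppose that $T:A\cup B\to A\cup B$ satisfies $T(A)\subseteq B$ and $T(B)\subseteq A$. If $\lim_{n\to\infty} d(T^n x,T^{n+1}x)=d(A,B)$ for some $x\in A\cup B$ satisfying $(x,Tx)\in E(G)$, then the pair $(A,B)$ is a $G$-approximate best proximity pair, i.e. for every given $\epsilon>0$, $P^{Ga}_{T}(A,B)\neq\emptyset$.
   Context: Throughout, $G$ is a directed graph without parallel edges whose vertex set $V(G)$ is the underlying metric space $X$ (so $E(G)\subseteq X\times X$; in this statement $X=V(G)=A\cup B$), and $E(G)$ contains the diagonal $\{(x,x):x\in X\}$. $d(A,B)=\inf\{d(a,b):a\in A,\ b\in B\}$. For a given $\epsilon>0$, $P^{Ga}_{T}(A,B)=\{x\in A\cup B:\ (x,Tx)\in E(G)\Rightarrow d(x,Tx)\le d(A,B)+\epsilon\}$. The pair $(A,B)$ is called a $G$-approximate best proximity pair if $P^{Ga}_{T}(A,B)\ne\emptyset$. *)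

theory Defs
  imports "HOL-Analysis.Analysis" "Graph_Theory.Pair_Digraph"
begin

(* A digraph without parallel edges is a pair digraph, whose arcs are ordered pairs of
   vertices (loops allowed). For nonempty A and B, setdist A B is the infimum of the
   distances dist a b. *)

(* Since the edge condition is the premise of an implication, a point x with
   (x, T x) not an edge belongs to this set for every eps. *)
definition G_approx_best_prox_points ::
  "('a::metric_space) pair_pre_digraph \<Rightarrow> ('a \<Rightarrow> 'a) \<Rightarrow> real \<Rightarrow> 'a set \<Rightarrow> 'a set \<Rightarrow> 'a set" where
  "G_approx_best_prox_points G T \<epsilon> A B =
     {x \<in> A \<union> B. (x, T x) \<in> parcs G \<longrightarrow> dist x (T x) \<le> setdist A B + \<epsilon>}"

definition G_approx_best_prox_pair ::
  "('a::metric_space) pair_pre_digraph \<Rightarrow> ('a \<Rightarrow> 'a) \<Rightarrow> 'a set \<Rightarrow> 'a set \<Rightarrow> bool" where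
  "G_approx_best_prox_pair G T A B \<longleftrightarrow>
     (\<forall>\<epsilon>>0. G_approx_best_prox_points G T \<epsilon> A B \<noteq> {})"

end

theory Submission
  imports Defs
begin

text \<open>The orbit of \<open>x\<close> stays in \<open>A \<union> B\<close>, so a late iterate \<open>y = (T ^^ n) x\<close> is a candidate
  for an approximate best proximity point. Its displacement \<open>dist y (T y)\<close> is the \<open>n\<close>-th term of
  the sequence converging to \<open>setdist A B\<close>, hence eventually below \<open>setdist A B + \<epsilon>\<close>.\<close>

theorem proposition3p4:
  fixes A B :: "('a::metric_space) set"
    and G :: "'a pair_pre_digraph"
    and T :: "'a \<Rightarrow> 'a"
  assumes "A \<noteq> {}" and "B \<noteq> {}"
    and "pair_wf_digraph G"
    and "pverts G = A \<union> B"
    and "Id_on (pverts G) \<subseteq> parcs G"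
    and "T \<in> A \<union> B \<rightarrow> A \<union> B"
    and "T ` A \<subseteq> B" and "T ` B \<subseteq> A"
    and "\<exists>x \<in> A \<union> B. (x, T x) \<in> parcs G \<and>
           (\<lambda>n. dist ((T ^^ n) x) ((T ^^ (n + 1)) x)) \<longlonglongrightarrow> setdist A B"
  shows "G_approx_best_prox_pair G T A B"
  unfolding G_approx_best_prox_pair_def
proof (intro allI impI)
  fix \<epsilon> :: real
  assume "\<epsilon> > 0"
  obtain x where x: "x \<in> A \<union> B"
    and lim: "(\<lambda>n. dist ((T ^^ n) x) ((T ^^ (n + 1)) x)) \<longlonglongrightarrow> setdist A B"
    using assms(9) by blast
  have orbit: "(T ^^ n) x \<in> A \<union> B" for n
  proof (induction n)
    case 0
    show ?case using x by simp
  next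
    case (Suc n)
    then show ?case using assms(6) by (simp add: Pi_iff)
  qed
  have "\<forall>\<^sub>F n in sequentially.
      dist ((T ^^ n) x) ((T ^^ (n + 1)) x) < setdist A B + \<epsilon>"
    using order_tendstoD(2)[OF lim] \<open>\<epsilon> > 0\<close> by simp
  then obtain n where "dist ((T ^^ n) x) (T ((T ^^ n) x)) < setdist A B + \<epsilon>"
    by (auto simp: eventually_sequentially)
  then have "(T ^^ n) x \<in> G_approx_best_prox_points G T \<epsilon> A B"
    using orbit[of n] by (simp add: G_approx_best_prox_points_def)
  then show "G_approx_best_prox_points G T \<epsilon> A B \<noteq> {}"
    by blast
qed

end
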